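(* For any $\alpha=(i,j)\in\mathbb{I}$, the dual basis matrix $v_\alpha$ is a rank $2$ matrix with nonzero eigenvalues $\frac12$ and $-\frac12+\frac1n$ and corresponding eigenvectors $a-b$ and $a+b$, independent of dimension, where $a=e_i-\frac1n\mathbf{1}$ and $b=e_j-\frac1n\mathbf{1}$.
   Context: Let $n$ be the number of points under consideration, and let $\mathbb{I}=\{(i,j):1\le i<j\le n\}$, of size $L=n(n-1)/2$. Let $e_i\in\mathbb{R}^n$ be the $i$-th standard basis vector and $\mathbf{1}\in\mathbb{R}^n$ the all-ones vector. Let $e_{i,j}\in\mathbb{R}^{n\times n}$ be the matrix whose only nonzero entry is a $1$ at position $(i,j)$. For $\alpha=(\alpha_1,\alpha_2)\in\mathbb{I}$ define $w_\alpha=e_{\alpha_1,\alpha_1}+e_{\alpha_2,\alpha_2}-e_{\alpha_1,\alpha_2}-e_{\alpha_2,\alpha_1}$; these form a basis of the space of symmetric $n\times n$ matrices $X$ with $X\mathbf{1}=0$. With the trace inner product $\langle X,Y\rangle=\operatorname{trace}(X^\top Y)$, let $H\in\mathbb{R}^{L\times L}$ have entries $H_{\alpha,\beta}=\langle w_\alpha,w_\beta\rangle$ (this matrix is symmetric positive definite). The dual basis matrices are $v_\alpha=\sum_{\beta\in\mathbb{I}}[H^{-1}]_{\alpha,\beta}\,w_\beta\in\mathbb{R}^{n\times n}$; they satisfy $\langle v_\alpha,w_\beta\rangle=\delta_\alpha^\beta$ for all $\alpha,\beta\in\mathbb{I}$, where $\delta_\alpha^\beta$ is $1$ if $\alpha=\beta$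 and $0$ otherwise. Explicitly, $v_\alpha=-\frac12(ab^\top+ba^\top)$ with $a,b$ as in the claim.
   Formalization: The formal theorem assumes n > 2; for n = 2 the claim fails, since then a = -b, the dual basis matrix has rank 1, a + b = 0 is not an eigenvector and -1/2 + 1/n = 0. *)

theory Defs
  imports
    Complex_Main
    "Jordan_Normal_Form.Char_Poly"
    "Jordan_Normal_Form.Gauss_Jordan_Elimination"
    "Jordan_Normal_Form.DL_Rank"
begin

(* Matrix and vector indices start at 0, so the points are 0, ..., n - 1 instead of
   1, ..., n; only the order of the indices matters. *)

definition pair_set :: "nat \<Rightarrow> (nat \<times> nat) set" where
  "pair_set n = {(i, j). i < j \<and> j < n}"

(* The entries of H are indexed by pairs, those of a matrix by numbers. pair_list fixes an
   enumeration of the pairs, and pair_pos is its inverse. The dual basis does not depend on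
   the choice of the enumeration. *)

definition pair_list :: "nat \<Rightarrow> (nat \<times> nat) list" where
  "pair_list n = concat (map (\<lambda>j. map (\<lambda>i. (i, j)) [0..<j]) [0..<n])"

lemma set_pair_list: "set (pair_list n) = pair_set n"
  by (auto simp: pair_list_def pair_set_def)

lemma length_pair_list: "length (pair_list n) = n * (n - 1) div 2"
proof -
  have "2 * length (pair_list n) = n * (n - 1)"
  proof (induction n)
    case 0
    show ?case by (simp add: pair_list_def)
  next
    case (Suc n)
    have "length (pair_list (Suc n)) = length (pair_list n) + n"
      by (simp add: pair_list_def)
    then show ?case using Suc by (cases n) (auto simp: algebra_simps)
  qed
  then show ?thesis by simp
qed

lemma distinct_pair_list: "distinct (pair_list n)"
proof (induction n)
  case 0
  show ?case by (simp add: pair_list_def)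
next
  case (Suc n)
  have *: "pair_list (Suc n) = pair_list n @ map (\<lambda>i. (i, n)) [0..<n]"
    by (simp add: pair_list_def)
  have "set (pair_list n) \<inter> set (map (\<lambda>i. (i, n)) [0..<n]) = {}"
    unfolding set_pair_list by (auto simp: pair_set_def)
  then show ?case using Suc unfolding * by (auto simp: distinct_map inj_on_def)
qed

definition pair_pos :: "nat \<Rightarrow> nat \<times> nat \<Rightarrow> nat" where
  "pair_pos n \<alpha> = (THE p. p < length (pair_list n) \<and> pair_list n ! p = \<alpha>)"

lemma pair_pos:
  assumes "\<alpha> \<in> pair_set n"
  shows "pair_pos n \<alpha> < length (pair_list n)" "pair_list n ! pair_pos n \<alpha> = \<alpha>"
proof -
  have "\<exists>!p. p < length (pair_list n) \<and> pair_list n ! p = \<alpha>"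
    using assms distinct_Ex1[OF distinct_pair_list] unfolding set_pair_list by blast
  from theI'[OF this]
  show "pair_pos n \<alpha> < length (pair_list n)" "pair_list n ! pair_pos n \<alpha> = \<alpha>"
    unfolding pair_pos_def by auto
qed

definition mat_trace :: "real mat \<Rightarrow> real" where
  "mat_trace A = (\<Sum>k<dim_row A. A $$ (k, k))"

definition trace_inner :: "real mat \<Rightarrow> real mat \<Rightarrow> real" where
  "trace_inner X Y = mat_trace (transpose_mat X * Y)"

definition elem_mat :: "nat \<Rightarrow> nat \<Rightarrow> nat \<Rightarrow> real mat" where
  "elem_mat n i j = mat n n (\<lambda>(r, c). if r = i \<and> c = j then 1 else 0)"

definition w_mat :: "nat \<Rightarrow> nat \<times> nat \<Rightarrow> real mat" where
  "w_mat n \<alpha> = elem_mat n (fst \<alpha>) (fst \<alpha>) + elem_mat n (snd \<alpha>) (snd \<alpha>)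
             - elem_mat n (fst \<alpha>) (snd \<alpha>) - elem_mat n (snd \<alpha>) (fst \<alpha>)"

definition H_mat :: "nat \<Rightarrow> real mat" where
  "H_mat n = mat (length (pair_list n)) (length (pair_list n))
     (\<lambda>(p, q). trace_inner (w_mat n (pair_list n ! p)) (w_mat n (pair_list n ! q)))"

(* The option is Some because H is positive definite. *)
definition H_inv :: "nat \<Rightarrow> real mat" where
  "H_inv n = the (mat_inverse (H_mat n))"

(* The linear combination of the matrices w, written entrywise because the type of matrices
   of arbitrary dimension has no zero for a sum to start from. *)
definition v_mat :: "nat \<Rightarrow> nat \<times> nat \<Rightarrow> real mat" where
  "v_mat n \<alpha> = mat n n (\<lambda>(r, c).
     \<Sum>\<beta>\<in>pair_set n. H_inv n $$ (pair_pos n \<alpha>, pair_pos n \<beta>) * w_mat n \<beta> $$ (r, c))"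

definition ones_vec :: "nat \<Rightarrow> real vec" where
  "ones_vec n = vec n (\<lambda>_. 1)"

(* The vectors a and b are centered_vec n i and centered_vec n j. For n = 2 they satisfy
   a + b = 0, and - 1 / 2 + 1 / n vanishes as well. *)
definition centered_vec :: "nat \<Rightarrow> nat \<Rightarrow> real vec" where
  "centered_vec n i = unit_vec n i - (1 / real n) \<cdot>\<^sub>v ones_vec n"

end

theory Submission
  imports Defs
begin

text \<open>
  The matrix \<open>- (a b\<^sup>T + b a\<^sup>T) / 2\<close> equals \<open>(p p\<^sup>T - q q\<^sup>T) / 4\<close> with \<open>p = a - b\<close> and \<open>q = a + b\<close>.
  As \<open>a\<close> and \<open>b\<close> have the same norm, \<open>p\<close> and \<open>q\<close> are orthogonal, so this is already a spectral
  decomposition: the nonzero eigenvalues are \<open>(p \<bullet> p) / 4\<close> and \<open>- (q \<bullet> q) / 4\<close>, and the column space is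
  spanned by \<open>p\<close> and \<open>q\<close>. From \<open>a \<bullet> a = b \<bullet> b = 1 - 1/n\<close> and \<open>a \<bullet> b = - 1/n\<close> one gets \<open>p \<bullet> p = 2\<close> and
  \<open>q \<bullet> q = 2 - 4/n\<close>, and the latter is nonzero because \<open>n > 2\<close>.

  What remains is that the dual basis matrix, defined through the inverse of the Gram matrix \<open>H\<close>,
  has this closed form (\<open>v_mat_eq\<close>). Let \<open>u\<^sub>\<alpha>\<close> be the closed form. Any symmetric \<open>X\<close> with vanishing
  row sums is \<open>\<Sum>\<^sub>\<beta> - X\<^sub>\<beta> w\<^sub>\<beta>\<close> (\<open>w_mat_expansion\<close>), as for a graph Laplacian with edge weights
  \<open>- X\<^sub>\<beta>\<close>. Applied to \<open>X = u\<^sub>\<alpha>\<close>, this makes the entries of \<open>- u\<^sub>\<alpha>\<close> at the pairs the coefficients of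
  \<open>u\<^sub>\<alpha>\<close> in the basis \<open>w\<close>. Together with the duality \<open>\<langle>u\<^sub>\<alpha>, w\<^sub>\<beta>\<rangle> = \<delta>\<close> (\<open>trace_inner_dual_mat\<close>) it says
  that the matrix \<open>G\<close> of these coefficients satisfies \<open>G H = I\<close>. Hence \<open>H\<close> is invertible and
  \<open>G\<close> is its inverse (\<open>H_inv_eq\<close>).
\<close>

section \<open>Matrices that are a sum of two orthogonal dyads\<close>

text \<open>The setting is \<open>A = s p p\<^sup>T + t q q\<^sup>T\<close>, expressed by the action of \<open>A\<close> on vectors, which is the
  form in which both the eigenvectors and the column space are read off.\<close>

locale orthogonal_dyads =
  fixes n :: nat and A :: "real mat" and p q :: "real vec" and s t :: real
  assumes A: "A \<in> carrier_mat n n"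
    and p: "p \<in> carrier_vec n" and q: "q \<in> carrier_vec n"
    and action: "\<And>x. x \<in> carrier_vec n \<Longrightarrow>
      A *\<^sub>v x = (s * (p \<bullet> x)) \<cdot>\<^sub>v p + (t * (q \<bullet> x)) \<cdot>\<^sub>v q"
    and orth: "p \<bullet> q = 0"
    and p_nonzero: "p \<bullet> p \<noteq> 0" and q_nonzero: "q \<bullet> q \<noteq> 0"
    and s_nonzero: "s \<noteq> 0" and t_nonzero: "t \<noteq> 0"
begin

lemma orth': "q \<bullet> p = 0"
  using orth comm_scalar_prod[OF p q] by simp

lemma inner_combination:
  shows "p \<bullet> (c \<cdot>\<^sub>v p + d \<cdot>\<^sub>v q) = c * (p \<bullet> p)" and "q \<bullet> (c \<cdot>\<^sub>v p + d \<cdot>\<^sub>v q) = d * (q \<bullet> q)"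
  using p q orth orth' by (simp_all add: scalar_prod_add_distrib[of _ n])

lemma combination_eq_0:
  assumes "c \<cdot>\<^sub>v p + d \<cdot>\<^sub>v q = 0\<^sub>v n"
  shows "c = 0" "d = 0"
  using inner_combination[of c d] assms p q p_nonzero q_nonzero by auto

lemma p_neq_0: "p \<noteq> 0\<^sub>v n" and q_neq_0: "q \<noteq> 0\<^sub>v n" and p_neq_q: "p \<noteq> q"
  using p_nonzero q_nonzero orth p q by auto

lemma mult_p: "A *\<^sub>v p = (s * (p \<bullet> p)) \<cdot>\<^sub>v p" and mult_q: "A *\<^sub>v q = (t * (q \<bullet> q)) \<cdot>\<^sub>v q"
  using action[OF p] action[OF q] p q orth orth' by (auto intro!: eq_vecI)

lemma eigenvector_p: "eigenvector A p (s * (p \<bullet> p))"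
  and eigenvector_q: "eigenvector A q (t * (q \<bullet> q))"
  using A p q p_neq_0 q_neq_0 mult_p mult_q unfolding eigenvector_def by auto

text \<open>Pairing \<open>A x = k x\<close> with \<open>p\<close> and with \<open>q\<close> gives \<open>(k - s (p \<bullet> p)) (p \<bullet> x) = 0\<close> and
  \<open>(k - t (q \<bullet> q)) (q \<bullet> x) = 0\<close>; if both \<open>p \<bullet> x\<close> and \<open>q \<bullet> x\<close> vanish, then \<open>A x = 0\<close> and so \<open>k = 0\<close>.\<close>

lemma nonzero_eigenvalues:
  "{k. eigenvalue A k \<and> k \<noteq> 0} = {s * (p \<bullet> p), t * (q \<bullet> q)}" (is "?L = ?R")
proof (rule Set.set_eqI, rule iffI)
  fix k assume "k \<in> ?L"
  then obtain x where x: "x \<in> carrier_vec n" "x \<noteq> 0\<^sub>v n" "A *\<^sub>v x = k \<cdot>\<^sub>v x" and k: "k \<noteq> 0"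
    using A unfolding eigenvalue_def eigenvector_def by auto
  have kx: "k \<cdot>\<^sub>v x = (s * (p \<bullet> x)) \<cdot>\<^sub>v p + (t * (q \<bullet> x)) \<cdot>\<^sub>v q"
    using action[OF x(1)] x(3) by simp
  have "k * (p \<bullet> x) = s * (p \<bullet> x) * (p \<bullet> p)"
    using inner_combination(1)[of "s * (p \<bullet> x)" "t * (q \<bullet> x)"] p x(1)
    unfolding kx[symmetric] by simp
  moreover have "k * (q \<bullet> x) = t * (q \<bullet> x) * (q \<bullet> q)"
    using inner_combination(2)[of "s * (p \<bullet> x)" "t * (q \<bullet> x)"] q x(1)
    unfolding kx[symmetric] by simp
  moreover have "p \<bullet> x \<noteq> 0 \<or> q \<bullet> x \<noteq> 0"
  proof (rule ccontr)
    assume "\<not> ?thesis"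
    then have "k \<cdot>\<^sub>v x = 0\<^sub>v n" using kx p q by (auto intro!: eq_vecI)
    then have "k * x $ r = 0" if "r < n" for r
      using that x(1) by (metis carrier_vecD index_smult_vec(1) index_zero_vec(1))
    then have "x = 0\<^sub>v n" using k x(1) by (intro eq_vecI) auto
    with x(2) show False by simp
  qed
  ultimately show "k \<in> ?R" by auto
next
  fix k assume "k \<in> ?R"
  then show "k \<in> ?L"
    using eigenvector_p eigenvector_q s_nonzero t_nonzero p_nonzero q_nonzero
    unfolding eigenvalue_def by auto
qed

text \<open>The image of \<open>A\<close> consists of combinations of \<open>p\<close> and \<open>q\<close>, and it contains both, being
  eigenvectors for nonzero eigenvalues; orthogonality makes them independent.\<close>

lemma rank_eq_2: "vec_space.rank n A = 2"
proof -
  interpret V: vec_space "TYPE(real)" n .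
  have sub: "{p, q} \<subseteq> carrier_vec n" using p q by simp
  have combine: "V.lincomb f {p, q} = f p \<cdot>\<^sub>v p + f q \<cdot>\<^sub>v q" for f
    using p q p_neq_q by (intro eq_vecI) (auto simp: V.lincomb_index V.lincomb_dim)
  have indep: "V.lin_indpt {p, q}"
  proof (rule V.finite_lin_indpt2)
    show "\<forall>v\<in>{p, q}. f v = 0" if "V.lincomb f {p, q} = 0\<^sub>v n" for f
      using that combination_eq_0 unfolding combine by auto
  qed (use sub in auto)
  have cols: "set (cols A) \<subseteq> carrier_vec n" using A cols_dim by blast
  have "V.span (set (cols A)) = V.span {p, q}"
  proof (rule equalityI)
    have "\<exists>x\<in>carrier_vec n. A *\<^sub>v x = v" if "v \<in> {p, q}" for v
    proof -
      have "A *\<^sub>v ((1 / (s * (p \<bullet> p))) \<cdot>\<^sub>v p) = p" "A *\<^sub>v ((1 / (t * (q \<bullet> q))) \<cdot>\<^sub>v q) = q"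
        using A p q mult_p mult_q s_nonzero t_nonzero p_nonzero q_nonzero
        by (auto simp: mult_mat_vec[of _ n n] smult_smult_assoc)
      then show ?thesis using that p q by (metis insertE singletonD smult_carrier_vec)
    qed
    then have "{p, q} \<subseteq> V.col_space A"
      using V.col_space_eq[OF A] A sub by auto
    then show "V.span {p, q} \<subseteq> V.span (set (cols A))"
      unfolding V.col_space_def by (intro V.span_subsetI cols)
    show "V.span (set (cols A)) \<subseteq> V.span {p, q}"
    proof (rule subsetI)
      fix y assume "y \<in> V.span (set (cols A))"
      then obtain x where "x \<in> carrier_vec n" "y = A *\<^sub>v x"
        using V.col_space_eq[OF A] A unfolding V.col_space_def by auto
      then have "y = V.lincomb (\<lambda>v. if v = p then s * (p \<bullet> x) else t * (q \<bullet> x)) {p, q}"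
        using action p_neq_q by (simp add: combine)
      then show "y \<in> V.span {p, q}" by (rule V.in_spanI) auto
    qed
  qed
  then have "V.rank A = vectorspace.dim class_ring (V.span_vs {p, q})"
    unfolding V.rank_def by simp
  also have "\<dots> = card {p, q}"
    using sub indep by (intro V.dim_span) (auto simp: maximal_def)
  also have "\<dots> = 2" using p_neq_q by simp
  finally show ?thesis .
qed

end

section \<open>The symmetrised product of two centred unit vectors\<close>

definition neg_sym_outer :: "nat \<Rightarrow> real vec \<Rightarrow> real vec \<Rightarrow> real mat" where
  "neg_sym_outer n a b = mat n n (\<lambda>(r, c). - (a $ r * b $ c + b $ r * a $ c) / 2)"

lemma neg_sym_outer_carrier: "neg_sym_outer n a b \<in> carrier_mat n n"
  unfolding neg_sym_outer_def by simp

text \<open>Polarisation, \<open>- 2 (a b\<^sup>T + b a\<^sup>T) = (a - b) (a - b)\<^sup>T - (a + b) (a + b)\<^sup>T\<close>, diagonalises the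
  symmetrised product.\<close>

lemma neg_sym_outer_mult_vec:
  assumes "a \<in> carrier_vec n" "b \<in> carrier_vec n" "x \<in> carrier_vec n"
  shows "neg_sym_outer n a b *\<^sub>v x
    = (1 / 4 * ((a - b) \<bullet> x)) \<cdot>\<^sub>v (a - b) + (- 1 / 4 * ((a + b) \<bullet> x)) \<cdot>\<^sub>v (a + b)"
proof (rule eq_vecI)
  fix r assume "r < dim_vec ((1 / 4 * ((a - b) \<bullet> x)) \<cdot>\<^sub>v (a - b) + (- 1 / 4 * ((a + b) \<bullet> x)) \<cdot>\<^sub>v (a + b))"
  then have r: "r < n" using assms by simp
  have "(neg_sym_outer n a b *\<^sub>v x) $ r = (\<Sum>c<n. - (a $ r * b $ c + b $ r * a $ c) / 2 * x $ c)"
    using r assms by (simp add: neg_sym_outer_def scalar_prod_def lessThan_atLeast0)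
  also have "\<dots> = - (a $ r) / 2 * (b \<bullet> x) - b $ r / 2 * (a \<bullet> x)"
    using assms unfolding scalar_prod_def sum_distrib_left sum_subtractf[symmetric]
    by (intro sum.cong) (auto simp: field_simps)
  also have "\<dots> = ((1 / 4 * ((a - b) \<bullet> x)) \<cdot>\<^sub>v (a - b) + (- 1 / 4 * ((a + b) \<bullet> x)) \<cdot>\<^sub>v (a + b)) $ r"
    using r assms
    by (simp add: minus_scalar_prod_distrib[of _ n] add_scalar_prod_distrib[of _ n] field_simps)
  finally show "(neg_sym_outer n a b *\<^sub>v x) $ r
    = ((1 / 4 * ((a - b) \<bullet> x)) \<cdot>\<^sub>v (a - b) + (- 1 / 4 * ((a + b) \<bullet> x)) \<cdot>\<^sub>v (a + b)) $ r" .
qed (use assms in \<open>simp add: neg_sym_outer_def\<close>)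

lemma centered_vec_carrier: "centered_vec n i \<in> carrier_vec n"
  unfolding centered_vec_def ones_vec_def by simp

lemma centered_vec_index:
  "r < n \<Longrightarrow> centered_vec n i $ r = (if r = i then 1 else 0) - 1 / real n"
  unfolding centered_vec_def ones_vec_def by (simp add: unit_vec_def)

lemma sum_centered_vec:
  assumes "i < n"
  shows "(\<Sum>r<n. centered_vec n i $ r) = 0"
proof -
  have "(\<Sum>r<n. centered_vec n i $ r) = (\<Sum>r<n. (if r = i then 1 else 0) - 1 / real n)"
    by (intro sum.cong) (auto simp: centered_vec_index)
  also have "\<dots> = 0" using assms by (simp add: sum_subtractf)
  finally show ?thesis .
qed

lemma centered_vec_scalar_prod:
  assumes "i < n" "j < n"
  shows "centered_vec n i \<bullet> centered_vec n j = (if i = j then 1 else 0) - 1 / real n"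
proof -
  have "centered_vec n i \<bullet> centered_vec n j
    = (\<Sum>r<n. ((if r = i then 1 else 0) - 1 / real n) * centered_vec n j $ r)"
    using centered_vec_carrier[of n j]
    by (auto simp: scalar_prod_def lessThan_atLeast0 centered_vec_index intro!: sum.cong)
  also have "\<dots> = (\<Sum>r<n. if r = i then centered_vec n j $ r else 0)
      - 1 / real n * (\<Sum>r<n. centered_vec n j $ r)"
    unfolding sum_distrib_left sum_subtractf[symmetric]
    by (intro sum.cong) (auto simp: algebra_simps)
  also have "\<dots> = centered_vec n j $ i"
    using assms sum_centered_vec by simp
  finally show ?thesis using assms by (simp add: centered_vec_index)
qed

section \<open>Expansion in the basis of pair matrices\<close>

lemma w_mat_carrier: "w_mat n \<alpha> \<in> carrier_mat n n"
  unfolding w_mat_def elem_mat_def by (intro carrier_matI) simp_all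

text \<open>The factorisation \<open>w\<^sub>(\<^sub>k\<^sub>,\<^sub>l\<^sub>) = (e\<^sub>k - e\<^sub>l) (e\<^sub>k - e\<^sub>l)\<^sup>T\<close> is symmetric in \<open>k\<close> and \<open>l\<close> and vanishes
  for \<open>k = l\<close>, so that sums over pairs can be replaced by sums over all \<open>k\<close> and \<open>l\<close>.\<close>

lemma w_mat_index:
  assumes "r < n" "c < n"
  shows "w_mat n (k, l) $$ (r, c) =
    (of_bool (k = r) - of_bool (l = r)) * (of_bool (k = c) - of_bool (l = c))"
  using assms
  by (cases "k = r"; cases "l = r"; cases "k = c"; cases "l = c") (simp_all add: w_mat_def elem_mat_def)

lemma trace_inner_w_mat:
  assumes "X \<in> carrier_mat n n" "k < n" "l < n"
  shows "trace_inner X (w_mat n (k, l)) = X $$ (k, k) + X $$ (l, l) - X $$ (k, l) - X $$ (l, k)"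
proof -
  have pick: "(\<Sum>r<n. f r * (of_bool (k = r) - of_bool (l = r))) = f k - f l" for f :: "nat \<Rightarrow> real"
    using assms by (simp add: right_diff_distrib sum_subtractf of_bool_def if_distrib[of "(*) _"] cong: if_cong)
  have "trace_inner X (w_mat n (k, l)) = (\<Sum>c<n. \<Sum>r<n. X $$ (r, c) * w_mat n (k, l) $$ (r, c))"
    using assms w_mat_carrier[of n "(k, l)"] unfolding trace_inner_def mat_trace_def
    by (auto simp: scalar_prod_def lessThan_atLeast0 intro!: sum.cong)
  also have "\<dots> = (\<Sum>c<n. (\<Sum>r<n. X $$ (r, c) * (of_bool (k = r) - of_bool (l = r)))
      * (of_bool (k = c) - of_bool (l = c)))"
    unfolding sum_distrib_right by (intro sum.cong refl) (simp add: w_mat_index mult.assoc)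
  also have "\<dots> = X $$ (k, k) - X $$ (l, k) - (X $$ (k, l) - X $$ (l, l))"
    unfolding pick by simp
  finally show ?thesis by simp
qed

lemma finite_pair_set: "finite (pair_set n)"
  using set_pair_list[of n] by (metis List.finite_set)

lemma sum_pair_set:
  fixes f :: "nat \<Rightarrow> nat \<Rightarrow> real"
  assumes sym: "\<And>k l. k < n \<Longrightarrow> l < n \<Longrightarrow> f k l = f l k" and diag: "\<And>k. k < n \<Longrightarrow> f k k = 0"
  shows "2 * (\<Sum>(k, l)\<in>pair_set n. f k l) = (\<Sum>k<n. \<Sum>l<n. f k l)"
proof -
  let ?D = "(\<lambda>k. (k, k)) ` {..<n}"
  have split: "{..<n} \<times> {..<n} = pair_set n \<union> prod.swap ` pair_set n \<union> ?D"
    by (auto simp: pair_set_def image_iff)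
  have "(\<Sum>k<n. \<Sum>l<n. f k l) = (\<Sum>(k, l)\<in>{..<n} \<times> {..<n}. f k l)"
    by (simp add: sum.cartesian_product)
  also have "\<dots> = (\<Sum>(k, l)\<in>pair_set n. f k l) + (\<Sum>(k, l)\<in>prod.swap ` pair_set n. f k l)
      + (\<Sum>(k, l)\<in>?D. f k l)"
  proof -
    have "pair_set n \<inter> prod.swap ` pair_set n = {}"
      "(pair_set n \<union> prod.swap ` pair_set n) \<inter> ?D = {}"
      by (auto simp: pair_set_def)
    then show ?thesis unfolding split
      by (simp only: sum.union_disjoint finite_UnI finite_imageI finite_pair_set finite_lessThan)
  qed
  also have "(\<Sum>(k, l)\<in>prod.swap ` pair_set n. f k l) = (\<Sum>(k, l)\<in>pair_set n. f k l)"
    by (subst sum.reindex) (auto simp: pair_set_def sym intro!: sum.cong)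
  also have "(\<Sum>(k, l)\<in>?D. f k l) = 0"
    using diag by (intro sum.neutral) auto
  finally show ?thesis by simp
qed

text \<open>Of the four terms of the product in \<open>w_mat_index\<close>, summed over all \<open>k\<close> and \<open>l\<close>, the mixed ones
  contribute \<open>X\<^sub>r\<^sub>c + X\<^sub>c\<^sub>r\<close>, and the other two are row and column sums of \<open>X\<close>.\<close>

lemma w_mat_expansion:
  assumes sym: "\<And>k l. k < n \<Longrightarrow> l < n \<Longrightarrow> X $$ (k, l) = X $$ (l, k)"
    and rows: "\<And>k. k < n \<Longrightarrow> (\<Sum>l<n. X $$ (k, l)) = 0"
    and r: "r < n" and c: "c < n"
  shows "(\<Sum>\<beta>\<in>pair_set n. - X $$ \<beta> * w_mat n \<beta> $$ (r, c)) = X $$ (r, c)"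
proof -
  let ?d = "\<lambda>k r. of_bool (k = r) :: real"
  have pick: "(\<Sum>k<n. f k * ?d k r) = f r" if "r < n" for f :: "nat \<Rightarrow> real" and r
    using that by (simp add: of_bool_def if_distrib cong: if_cong)
  have cols: "(\<Sum>k<n. X $$ (k, l)) = 0" if "l < n" for l
  proof -
    have "(\<Sum>k<n. X $$ (k, l)) = (\<Sum>k<n. X $$ (l, k))"
      using sym that by (intro sum.cong) auto
    then show ?thesis using rows that by simp
  qed
  have "2 * (\<Sum>\<beta>\<in>pair_set n. - X $$ \<beta> * w_mat n \<beta> $$ (r, c))
      = 2 * (\<Sum>(k, l)\<in>pair_set n. - X $$ (k, l) * ((?d k r - ?d l r) * (?d k c - ?d l c)))"
    using r c by (intro arg_cong[where f = "(*) 2"] sum.cong) (auto simp: w_mat_index)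
  also have "\<dots> = (\<Sum>k<n. \<Sum>l<n. - X $$ (k, l) * ((?d k r - ?d l r) * (?d k c - ?d l c)))"
    by (rule sum_pair_set) (use sym in \<open>auto simp: algebra_simps\<close>)
  also have "\<dots> = (\<Sum>k<n. \<Sum>l<n. X $$ (k, l) * ?d l c * ?d k r)
      + (\<Sum>k<n. \<Sum>l<n. X $$ (k, l) * ?d l r * ?d k c)
      - (\<Sum>k<n. \<Sum>l<n. X $$ (k, l) * ?d k c * ?d k r)
      - (\<Sum>k<n. \<Sum>l<n. X $$ (k, l) * ?d l c * ?d l r)"
    unfolding sum.distrib[symmetric] sum_subtractf[symmetric]
    by (intro sum.cong refl) (simp add: algebra_simps)
  also have "(\<Sum>k<n. \<Sum>l<n. X $$ (k, l) * ?d l c * ?d k r) = X $$ (r, c)"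
    unfolding sum_distrib_right[symmetric] using r c by (simp add: pick)
  also have "(\<Sum>k<n. \<Sum>l<n. X $$ (k, l) * ?d l r * ?d k c) = X $$ (c, r)"
    unfolding sum_distrib_right[symmetric] using r c by (simp add: pick)
  also have "(\<Sum>k<n. \<Sum>l<n. X $$ (k, l) * ?d k c * ?d k r) = 0"
    unfolding sum_distrib_right[symmetric] by (simp add: rows)
  also have "(\<Sum>k<n. \<Sum>l<n. X $$ (k, l) * ?d l c * ?d l r) = 0"
    by (subst sum.swap) (simp add: sum_distrib_right[symmetric] cols)
  finally show ?thesis using sym[OF c r] by simp
qed

section \<open>The dual basis in closed form\<close>

definition dual_mat :: "nat \<Rightarrow> nat \<times> nat \<Rightarrow> real mat" where
  "dual_mat n \<alpha> = neg_sym_outer n (centered_vec n (fst \<alpha>)) (centered_vec n (snd \<alpha>))"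

lemma dual_mat_carrier: "dual_mat n \<alpha> \<in> carrier_mat n n"
  unfolding dual_mat_def by (rule neg_sym_outer_carrier)

lemma dual_mat_expansion:
  assumes "\<alpha> \<in> pair_set n" "r < n" "c < n"
  shows "(\<Sum>\<beta>\<in>pair_set n. - dual_mat n \<alpha> $$ \<beta> * w_mat n \<beta> $$ (r, c)) = dual_mat n \<alpha> $$ (r, c)"
proof (rule w_mat_expansion)
  obtain i j where \<alpha>: "\<alpha> = (i, j)" by (cases \<alpha>)
  then have ij: "i < n" "j < n" using assms by (auto simp: pair_set_def)
  let ?a = "centered_vec n i" and ?b = "centered_vec n j"
  show "(\<Sum>l<n. dual_mat n \<alpha> $$ (k, l)) = 0" if "k < n" for k
  proof -
    have "(\<Sum>l<n. dual_mat n \<alpha> $$ (k, l))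
      = - (?a $ k / 2) * (\<Sum>l<n. ?b $ l) - ?b $ k / 2 * (\<Sum>l<n. ?a $ l)"
      unfolding sum_distrib_left sum_subtractf[symmetric] using that \<alpha>
      by (intro sum.cong) (auto simp: dual_mat_def neg_sym_outer_def field_simps)
    then show ?thesis using sum_centered_vec ij by simp
  qed
qed (use assms in \<open>auto simp: dual_mat_def neg_sym_outer_def\<close>)

text \<open>The inner product factors as \<open>- (a\<^sub>k - a\<^sub>l) (b\<^sub>k - b\<^sub>l)\<close>, in which the centring cancels; both
  factors are nonzero only if \<open>k\<close> and \<open>l\<close> are \<open>i\<close> and \<open>j\<close>, and the order of the pairs then forces
  \<open>k = i\<close> and \<open>l = j\<close>.\<close>

lemma trace_inner_dual_mat:
  assumes "\<alpha> \<in> pair_set n" "\<beta> \<in> pair_set n"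
  shows "trace_inner (dual_mat n \<alpha>) (w_mat n \<beta>) = of_bool (\<alpha> = \<beta>)"
proof -
  obtain i j k l where \<alpha>: "\<alpha> = (i, j)" and \<beta>: "\<beta> = (k, l)" by (cases \<alpha>, cases \<beta>)
  have lt: "i < j" "j < n" "k < l" "l < n" using assms \<alpha> \<beta> by (auto simp: pair_set_def)
  let ?a = "centered_vec n i" and ?b = "centered_vec n j"
  have "trace_inner (dual_mat n \<alpha>) (w_mat n \<beta>) = - (?a $ k - ?a $ l) * (?b $ k - ?b $ l)"
    unfolding \<beta> using lt \<alpha>
    by (subst trace_inner_w_mat[OF dual_mat_carrier])
      (auto simp: dual_mat_def neg_sym_outer_def field_simps)
  also have "\<dots> = of_bool (\<alpha> = \<beta>)"
    using lt \<alpha> \<beta> by (auto simp: centered_vec_index)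
  finally show ?thesis .
qed

lemma sum_pair_list:
  "(\<Sum>p<length (pair_list n). f (pair_list n ! p)) = (\<Sum>\<beta>\<in>pair_set n. f \<beta>)"
  using bij_betw_nth[OF distinct_pair_list refl set_pair_list[symmetric]]
  by (rule sum.reindex_bij_betw)

text \<open>Summing the coefficients of \<open>u\<^sub>\<alpha>\<close> against \<open>\<langle>w\<^sub>\<gamma>, w\<^sub>\<beta>\<rangle>\<close> gives \<open>\<langle>u\<^sub>\<alpha>, w\<^sub>\<beta>\<rangle>\<close>, so the coefficient matrix
  is a left inverse of \<open>H\<close>; a one-sided inverse of a square matrix is the inverse.\<close>

lemma H_inv_eq:
  "H_inv n = mat (length (pair_list n)) (length (pair_list n))
     (\<lambda>(p, q). - dual_mat n (pair_list n ! p) $$ (pair_list n ! q))" (is "_ = ?G")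
proof -
  let ?L = "length (pair_list n)" and ?\<pi> = "\<lambda>p. pair_list n ! p"
  have H: "H_mat n \<in> carrier_mat ?L ?L" and G: "?G \<in> carrier_mat ?L ?L"
    unfolding H_mat_def by auto
  have GH: "?G * H_mat n = 1\<^sub>m ?L"
  proof (rule eq_matI)
    fix p q assume "p < dim_row (1\<^sub>m ?L)" "q < dim_col (1\<^sub>m ?L)"
    then have pq: "p < ?L" "q < ?L" by auto
    have mem: "?\<pi> r \<in> pair_set n" if "r < ?L" for r
      using nth_mem[OF that] set_pair_list by blast
    obtain k l where kl: "?\<pi> q = (k, l)" by (cases "?\<pi> q")
    then have lt: "k < n" "l < n" using mem[OF pq(2)] by (auto simp: pair_set_def)
    let ?f = "\<lambda>r c. \<Sum>\<gamma>\<in>pair_set n. - dual_mat n (?\<pi> p) $$ \<gamma> * w_mat n \<gamma> $$ (r, c)"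
    have "(?G * H_mat n) $$ (p, q)
      = (\<Sum>r<?L. - dual_mat n (?\<pi> p) $$ (?\<pi> r) * trace_inner (w_mat n (?\<pi> r)) (w_mat n (k, l)))"
      using pq kl by (simp add: H_mat_def scalar_prod_def lessThan_atLeast0)
    also have "\<dots> = (\<Sum>\<gamma>\<in>pair_set n. - dual_mat n (?\<pi> p) $$ \<gamma> * trace_inner (w_mat n \<gamma>) (w_mat n (k, l)))"
      by (rule sum_pair_list)
    also have "\<dots> = ?f k k + ?f l l - ?f k l - ?f l k"
      unfolding sum.distrib[symmetric] sum_subtractf[symmetric]
      by (intro sum.cong refl) (simp add: trace_inner_w_mat[OF w_mat_carrier lt] algebra_simps)
    also have "\<dots> = trace_inner (dual_mat n (?\<pi> p)) (w_mat n (k, l))"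
      using lt by (simp only: dual_mat_expansion[OF mem[OF pq(1)]] trace_inner_w_mat[OF dual_mat_carrier])
    also have "\<dots> = of_bool (?\<pi> p = ?\<pi> q)"
      using trace_inner_dual_mat[OF mem[OF pq(1)] mem[OF pq(2)]] kl by simp
    also have "\<dots> = 1\<^sub>m ?L $$ (p, q)"
      using pq nth_eq_iff_index_eq[OF distinct_pair_list] by auto
    finally show "(?G * H_mat n) $$ (p, q) = 1\<^sub>m ?L $$ (p, q)" .
  qed (use H G in auto)
  have HG: "H_mat n * ?G = 1\<^sub>m ?L" by (rule mat_mult_left_right_inverse[OF G H GH])
  show ?thesis
  proof (cases "mat_inverse (H_mat n)")
    case None
    have "H_mat n \<in> Units (ring_mat TYPE(real) ?L ())"
      unfolding Units_def using H G GH HG by (auto simp: ring_mat_simps)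
    with mat_inverse(1)[OF H None, where b = "()"] show ?thesis by blast
  next
    case (Some B)
    from mat_inverse(2)[OF H Some] have B: "B * H_mat n = 1\<^sub>m ?L" "B \<in> carrier_mat ?L ?L" by auto
    have "B = B * (H_mat n * ?G)" unfolding HG using B(2) by simp
    also have "\<dots> = ?G" using assoc_mult_mat[OF B(2) H G] B(1) G by simp
    finally show ?thesis unfolding H_inv_def Some by simp
  qed
qed

lemma v_mat_eq:
  assumes "\<alpha> \<in> pair_set n"
  shows "v_mat n \<alpha> = dual_mat n \<alpha>"
proof (rule eq_matI)
  fix r c assume "r < dim_row (dual_mat n \<alpha>)" "c < dim_col (dual_mat n \<alpha>)"
  then have rc: "r < n" "c < n" using dual_mat_carrier[of n \<alpha>] by auto
  have "v_mat n \<alpha> $$ (r, c) = (\<Sum>\<beta>\<in>pair_set n. - dual_mat n \<alpha> $$ \<beta> * w_mat n \<beta> $$ (r, c))"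
    unfolding v_mat_def using rc assms
    by (auto simp: H_inv_eq pair_pos intro!: sum.cong)
  then show "v_mat n \<alpha> $$ (r, c) = dual_mat n \<alpha> $$ (r, c)"
    using dual_mat_expansion[OF assms rc] by simp
qed (use dual_mat_carrier[of n \<alpha>] in \<open>auto simp: v_mat_def\<close>)

section \<open>Spectrum of the dual basis\<close>

theorem claim4:
  fixes n i j :: nat and a b :: "real vec"
  assumes "n > 2"
    and "(i, j) \<in> pair_set n"
  defines "a \<equiv> centered_vec n i"
    and "b \<equiv> centered_vec n j"
  shows "vec_space.rank n (v_mat n (i, j)) = 2
    \<and> {k. eigenvalue (v_mat n (i, j)) k \<and> k \<noteq> 0} = {1 / 2, - 1 / 2 + 1 / real n}
    \<and> eigenvector (v_mat n (i, j)) (a - b) (1 / 2)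
    \<and> eigenvector (v_mat n (i, j)) (a + b) (- 1 / 2 + 1 / real n)"
proof -
  have ij: "i < n" "j < n" "i \<noteq> j" using assms(2) by (auto simp: pair_set_def)
  have carrier: "a \<in> carrier_vec n" "b \<in> carrier_vec n"
    unfolding a_def b_def by (rule centered_vec_carrier)+
  have v: "v_mat n (i, j) = neg_sym_outer n a b"
    unfolding v_mat_eq[OF assms(2)] dual_mat_def a_def b_def by simp
  have gram: "a \<bullet> a = 1 - 1 / real n" "b \<bullet> b = 1 - 1 / real n"
      "a \<bullet> b = - 1 / real n" "b \<bullet> a = - 1 / real n"
    unfolding a_def b_def using ij by (simp_all add: centered_vec_scalar_prod)
  note bilinear = minus_scalar_prod_distrib[of _ n] add_scalar_prod_distrib[of _ n]
    scalar_prod_minus_distrib[of _ n] scalar_prod_add_distrib[of _ n]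
  have norms: "(a - b) \<bullet> (a - b) = 2" "(a + b) \<bullet> (a + b) = 2 - 4 / real n"
      and orth: "(a - b) \<bullet> (a + b) = 0"
    using carrier gram by (simp_all add: bilinear)
  have "4 / real n \<noteq> 2" using assms(1) by (simp add: field_simps)
  then interpret orthogonal_dyads n "neg_sym_outer n a b" "a - b" "a + b" "1 / 4" "- 1 / 4"
    using carrier neg_sym_outer_carrier neg_sym_outer_mult_vec[OF carrier] norms orth
    by unfold_locales auto
  have eigs: "1 / 4 * ((a - b) \<bullet> (a - b)) = 1 / 2"
      "- 1 / 4 * ((a + b) \<bullet> (a + b)) = - 1 / 2 + 1 / real n"
    unfolding norms by (simp_all add: algebra_simps)
  show ?thesis
    unfolding v using rank_eq_2 nonzero_eigenvalues eigenvector_p eigenvector_q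
    unfolding eigs by blast
qed

end
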